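(* Let $m$ and $n$ be positive integers. Write a partition of $n$ in multiplicity form as $n=t_1+2t_2+\cdots+nt_n$, where $t_i\ge 0$ is the number of times the part $i$ occurs (and $t_i=0$ for $i>n$). Then, for each choice of sign $\epsilon\in\{+1,-1\}$, \[ \sum_{t_1+2t_2+\cdots+nt_n=n}\epsilon^{\,t_m+t_{2m}+t_{3m}+\cdots}\left(t_m+2t_{2m}+3t_{3m}+\cdots\right) =\sum_{t_1+2t_2+\cdots+nt_n=n}\epsilon^{\,\lfloor t_1/m\rfloor+\lfloor t_2/m\rfloor+\cdots+\lfloor t_n/m\rfloor}\left(\lfloor t_1/m\rfloor+2\lfloor t_2/m\rfloor+\cdots+n\lfloor t_n/m\rfloor\right), \] and \[ \sum_{t_1+2t_2+\cdots+nt_n=n}\epsilon^{\,t_m+t_{2m}+t_{3m}+\cdots}\sum_{i\ge 0}\sum_{j=1}^{m-1}(im+j)\,t_{im+j} =\sum_{t_1+2t_2+\cdots+nt_n=n}\epsilon^{\,\lfloor t_1/m\rfloor+\lfloor t_2/m\rfloor+\cdots+\lfloor t_n/m\rfloor}\left(\langle t_1\rangle_m+2\langle t_2\rangle_m+\cdots+n\langle t_n\rangle_m\right), \] where both sums range over all partitions of $n$.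
   Context: $\lfloor x\rfloor$ denotes the integer part of a real number $x$. For an integer $x$, $\langle x\rangle_m$ denotes the least non-negative integer $r$ with $x\equiv r\pmod m$. *)

theory Defs
  imports Complex_Main
begin

text \<open>
  Partitions of \<open>n\<close> in multiplicity form: \<open>t i\<close> is the number of occurrences of the
  part \<open>i\<close>.  Requiring \<open>t 0 = 0\<close> (the number \<open>0\<close> is not a part) makes \<open>t\<close> unique for
  each partition.
\<close>

definition partitions_of :: "nat \<Rightarrow> (nat \<Rightarrow> nat) set" where
  "partitions_of n = {t. (\<forall>i. i \<notin> {1..n} \<longrightarrow> t i = 0) \<and> (\<Sum>i=1..n. i * t i) = n}"

lemma finite_partitions_of: "finite (partitions_of n)"
proof (rule finite_subset)
  show "partitions_of n \<subseteq> {t. \<forall>i. (i \<in> {1..n} \<longrightarrow> t i \<in> {..n}) \<and> (i \<notin> {1..n} \<longrightarrow> t i = 0)}"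
  proof
    fix t assume t: "t \<in> partitions_of n"
    have "t i \<le> n" if "i \<in> {1..n}" for i
    proof -
      have "i * t i \<le> (\<Sum>i=1..n. i * t i)"
        using that by (intro member_le_sum) auto
      also have "\<dots> = n"
        using t by (simp add: partitions_of_def)
      finally have "i * t i \<le> n" .
      moreover have "1 * t i \<le> i * t i"
        using that by (intro mult_le_mono1) simp
      ultimately show ?thesis
        by linarith
    qed
    then show "t \<in> {t. \<forall>i. (i \<in> {1..n} \<longrightarrow> t i \<in> {..n}) \<and> (i \<notin> {1..n} \<longrightarrow> t i = 0)}"
      using t by (auto simp: partitions_of_def)
  qed
  show "finite {t. \<forall>i. (i \<in> {1..n} \<longrightarrow> t i \<in> {..n}) \<and> (i \<notin> {1..n} \<longrightarrow> t i = (0::nat))}"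
    by (rule finite_set_of_finite_funs) auto
qed

text \<open>
  The series \<open>t m + t (2 * m) + t (3 * m) + \<dots>\<close> and its relatives have only zero terms
  once the index exceeds \<open>n\<close>.  For \<open>m \<ge> 1\<close> and \<open>k > n\<close> we have \<open>k * m > n\<close>, so summing
  over \<open>k \<le> n\<close> loses nothing.
\<close>

definition mult_parts :: "nat \<Rightarrow> nat \<Rightarrow> (nat \<Rightarrow> nat) \<Rightarrow> nat" where
  "mult_parts m n t = (\<Sum>k=1..n. t (k * m))"

definition weighted_mult_parts :: "nat \<Rightarrow> nat \<Rightarrow> (nat \<Rightarrow> nat) \<Rightarrow> nat" where
  "weighted_mult_parts m n t = (\<Sum>k=1..n. k * t (k * m))"

definition nonmult_part_sum :: "nat \<Rightarrow> nat \<Rightarrow> (nat \<Rightarrow> nat) \<Rightarrow> nat" where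
  "nonmult_part_sum m n t = (\<Sum>i=0..n. \<Sum>j=1..<m. (i * m + j) * t (i * m + j))"

end

theory Submission imports Defs begin

text \<open>
  Removing the multiples of \<open>m\<close> from a partition of \<open>n\<close> (and dividing them by \<open>m\<close>), or removing
  as many groups of \<open>m\<close> equal parts as possible, both leave a partition \<open>a\<close> of some \<open>A\<close> and a
  remainder of size \<open>n - m * A\<close>.  In both cases the fibre over \<open>a\<close> is in bijection with the fibre
  over the empty partition in size \<open>n - m * A\<close>.  Counting all partitions of \<open>n\<close> by fibres gives
  the same triangular recursion for the sizes of the empty fibres (Glaisher's theorem), so \<open>a\<close> is
  equidistributed under the two procedures; all statistics in the theorem are functions of \<open>a\<close>.
\<close>

section \<open>Support bounds, uniqueness of size, and addition of partitions\<close>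

lemma partitions_of_iff:
  assumes "\<And>i. i \<notin> {1..N} \<Longrightarrow> t i = 0"
  shows "t \<in> partitions_of n \<longleftrightarrow> (\<Sum>i=1..N. i * t i) = n"
proof -
  have eq: "(\<Sum>i=1..n. i * t i) = (\<Sum>i=1..N. i * t i)" if "\<And>i. i \<notin> {1..n} \<Longrightarrow> t i = 0"
  proof -
    have "(\<Sum>i=1..n. i * t i) = (\<Sum>i\<in>{1..n} \<inter> {1..N}. i * t i)"
      using assms by (intro sum.mono_neutral_right) auto
    also have "\<dots> = (\<Sum>i=1..N. i * t i)"
      using that by (intro sum.mono_neutral_left) auto
    finally show ?thesis .
  qed
  \<comment> \<open>A part that occurs contributes at least its own size to the sum, so no part
    exceeds \<open>n\<close>, however large \<open>N\<close> is.\<close>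
  have supp: "t i = 0" if n: "(\<Sum>i=1..N. i * t i) = n" and i: "i \<notin> {1..n}" for i
  proof (rule ccontr)
    assume "t i \<noteq> 0"
    with assms[of i] have "i \<in> {1..N}" by metis
    then have "i * t i \<le> (\<Sum>i=1..N. i * t i)"
      by (intro member_le_sum) auto
    moreover have "i \<le> i * t i" using \<open>t i \<noteq> 0\<close> by simp
    ultimately have "i \<le> n" using n by linarith
    then have "i \<in> {1..n}" using \<open>i \<in> {1..N}\<close> by simp
    with i show False by contradiction
  qed
  show ?thesis
  proof
    assume "t \<in> partitions_of n"
    then have "\<And>i. i \<notin> {1..n} \<Longrightarrow> t i = 0" "(\<Sum>i=1..n. i * t i) = n"
      unfolding partitions_of_def by blast+
    with eq show "(\<Sum>i=1..N. i * t i) = n" by metis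
  next
    assume n: "(\<Sum>i=1..N. i * t i) = n"
    with eq[OF supp[OF n]] supp[OF n] show "t \<in> partitions_of n"
      unfolding partitions_of_def by simp
  qed
qed

lemma partitions_of_support: "t \<in> partitions_of n \<Longrightarrow> i \<notin> {1..n} \<Longrightarrow> t i = 0"
  by (auto simp: partitions_of_def)

lemma partitions_of_unique:
  assumes "t \<in> partitions_of n" "t \<in> partitions_of k"
  shows "n = k"
  using assms partitions_of_iff[of n t n] partitions_of_iff[of n t k]
    partitions_of_support[OF assms(1)] by simp

lemma partitions_of_0: "partitions_of 0 = {\<lambda>_. 0}"
  by (auto simp: partitions_of_def)

text \<open>Adding multiplicities is the union of multisets of parts, so sizes add; since the size
  of \<open>v\<close> is known, the size of \<open>u\<close> can be recovered from the
  total.\<close>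

lemma add_in_partitions_of_iff:
  assumes v: "v \<in> partitions_of k"
  shows "(\<lambda>i. u i + v i) \<in> partitions_of (k + n) \<longleftrightarrow> u \<in> partitions_of n"
proof -
  define N where "N = k + n"
  have v0: "v i = 0" if "i \<notin> {1..N}" for i
    using that partitions_of_support[OF v] by (auto simp: N_def)
  have vs: "(\<Sum>i=1..N. i * v i) = k"
    using partitions_of_iff[of N v k, OF v0] v by simp
  show ?thesis
  proof (cases "\<forall>i. i \<notin> {1..N} \<longrightarrow> u i = 0")
    case True
    then show ?thesis
      using partitions_of_iff[of N u n] partitions_of_iff[of N "\<lambda>i. u i + v i" "k + n"] v0 vs
      by (simp add: distrib_left sum.distrib)
  next
    \<comment> \<open>A nonzero value of \<open>u\<close> outside \<open>{1..k + n}\<close> makes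
      both sides of the equivalence false.\<close>
    case False
    then obtain i where i: "i \<notin> {1..N}" "u i \<noteq> 0" by blast
    then show ?thesis
      using partitions_of_support[of "\<lambda>i. u i + v i" "k + n" i] partitions_of_support[of u n i]
      by (auto simp: N_def)
  qed
qed

lemma partitions_of_mono:
  assumes t: "t \<in> partitions_of n" and v: "v \<in> partitions_of k" and le: "\<And>i. v i \<le> t i"
  shows "k \<le> n"
proof -
  have "v i = 0" if "i \<notin> {1..n}" for i
    using le[of i] partitions_of_support[OF t that] by simp
  then have "k = (\<Sum>i=1..n. i * v i)"
    using v partitions_of_iff[of n v k] by simp
  also have "\<dots> \<le> (\<Sum>i=1..n. i * t i)" by (intro sum_mono mult_le_mono2 le)
  also have "\<dots> = n" using t by (simp add: partitions_of_def)
  finally show ?thesis .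
qed

section \<open>Fibres of an abstract partition quotient\<close>

lemma finite_mult_le:
  fixes m n :: nat
  assumes "m \<ge> 1"
  shows "finite {k. m * k \<le> n}"
proof (rule finite_subset)
  have "k \<le> m * k" for k using assms by simp
  then show "{k. m * k \<le> n} \<subseteq> {..n}" using order.trans by blast
qed simp

text \<open>For the two quotients used below this counts the partitions of \<open>n\<close> with no
  part divisible by \<open>m\<close>, and those in which every part occurs fewer than
  \<open>m\<close> times.\<close>

definition empty_fibre :: "((nat \<Rightarrow> nat) \<Rightarrow> nat \<Rightarrow> nat) \<Rightarrow> nat \<Rightarrow> nat" where
  "empty_fibre q n = card {t \<in> partitions_of n. q t = (\<lambda>_. 0)}"

text \<open>Here \<open>q\<close> reads off the quotient partition and \<open>e\<close> restores the
  parts that it stands for. By \<open>e_q_le\<close> these parts really occur in \<open>t\<close>;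
  by \<open>q_add\<close>, putting in \<open>e a\<close> shifts the quotient by exactly
  \<open>a\<close>; by \<open>e_in\<close>, restoring multiplies the size by
  \<open>m\<close>.\<close>

locale partition_quotient =
  fixes m :: nat and q e :: "(nat \<Rightarrow> nat) \<Rightarrow> nat \<Rightarrow> nat"
  assumes m_pos: "m \<ge> 1"
    and q_add: "q (\<lambda>i. u i + e a i) = (\<lambda>i. q u i + a i)"
    and e_q_le: "e (q t) i \<le> t i"
    and e_in: "a \<in> partitions_of k \<Longrightarrow> e a \<in> partitions_of (m * k)"
    and q_in: "t \<in> partitions_of n \<Longrightarrow> \<exists>k. q t \<in> partitions_of k"
begin

lemma card_fibre:
  assumes a: "a \<in> partitions_of k"
  shows "card {t \<in> partitions_of (m * k + n). q t = a} = empty_fibre q n"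
proof -
  have "bij_betw (\<lambda>u i. u i + e a i) {t \<in> partitions_of n. q t = (\<lambda>_. 0)}
          {t \<in> partitions_of (m * k + n). q t = a}"
  proof (rule bij_betwI')
    fix x y
    show "((\<lambda>i. x i + e a i) = (\<lambda>i. y i + e a i)) = (x = y)" by (auto simp: fun_eq_iff)
  next
    fix x assume "x \<in> {t \<in> partitions_of n. q t = (\<lambda>_. 0)}"
    then show "(\<lambda>i. x i + e a i) \<in> {t \<in> partitions_of (m * k + n). q t = a}"
      by (simp add: q_add add_in_partitions_of_iff[OF e_in[OF a]])
  next
    fix y assume y: "y \<in> {t \<in> partitions_of (m * k + n). q t = a}"
    \<comment> \<open>Truncated subtraction is exact here: \<open>a = q y\<close>, so
      \<open>e_q_le\<close> gives \<open>e a i \<le> y i\<close>.\<close>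
    define x where "x = (\<lambda>i. y i - e a i)"
    have eq: "y = (\<lambda>i. x i + e a i)" using y e_q_le[of y] by (auto simp: x_def)
    have "x \<in> partitions_of n" using y eq add_in_partitions_of_iff[OF e_in[OF a]] by auto
    moreover have "(\<lambda>i. q x i + a i) = a" using y q_add[of x a] eq by auto
    then have "q x = (\<lambda>_. 0)" by (auto simp: fun_eq_iff)
    ultimately show "\<exists>x\<in>{t \<in> partitions_of n. q t = (\<lambda>_. 0)}. y = (\<lambda>i. x i + e a i)"
      using eq by auto
  qed
  then show ?thesis by (simp add: empty_fibre_def bij_betw_same_card)
qed

text \<open>Group the partitions of \<open>n\<close> by their quotient, and the quotients by their
  size \<open>k\<close>. By \<open>card_fibre\<close> the number of preimages depends on
  \<open>k\<close> alone, so it factors out of the inner sum.\<close>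

lemma sum_quotient:
  fixes f :: "(nat \<Rightarrow> nat) \<Rightarrow> int"
  shows "(\<Sum>t\<in>partitions_of n. f (q t)) =
    (\<Sum>k | m * k \<le> n. sum f (partitions_of k) * int (empty_fibre q (n - m * k)))"
proof -
  define K where "K = {k. m * k \<le> n}"
  have finK: "finite K" unfolding K_def using m_pos by (rule finite_mult_le)
  have img: "q ` partitions_of n \<subseteq> (\<Union>k\<in>K. partitions_of k)"
  proof
    fix a assume "a \<in> q ` partitions_of n"
    then obtain t where t: "t \<in> partitions_of n" "a = q t" by blast
    then obtain k where k: "a \<in> partitions_of k" using q_in by blast
    \<comment> \<open>The restored partition \<open>e (q t)\<close> has size \<open>m * k\<close>
      and lies pointwise below \<open>t\<close>.\<close>
    have "m * k \<le> n"
      using partitions_of_mono[OF t(1) e_in[OF k]] e_q_le t(2) by blast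
    with k show "a \<in> (\<Union>k\<in>K. partitions_of k)" by (auto simp: K_def)
  qed
  have "(\<Sum>t\<in>partitions_of n. f (q t)) =
      (\<Sum>a\<in>(\<Union>k\<in>K. partitions_of k). \<Sum>t | t \<in> partitions_of n \<and> q t = a. f (q t))"
    using finK img by (intro sum.group[symmetric]) (auto simp: finite_partitions_of)
  also have "\<dots> = (\<Sum>k\<in>K. \<Sum>a\<in>partitions_of k. \<Sum>t | t \<in> partitions_of n \<and> q t = a. f (q t))"
    using finK partitions_of_unique
    by (intro sum.UNION_disjoint) (auto simp: finite_partitions_of)
  also have "\<dots> = (\<Sum>k\<in>K. \<Sum>a\<in>partitions_of k. f a * int (empty_fibre q (n - m * k)))"
  proof (intro sum.cong refl)
    fix k a assume k: "k \<in> K" and a: "a \<in> partitions_of k"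
    have "card {t \<in> partitions_of n. q t = a} = empty_fibre q (n - m * k)"
      using card_fibre[OF a, of "n - m * k"] k by (simp add: K_def)
    then show "(\<Sum>t | t \<in> partitions_of n \<and> q t = a. f (q t)) =
        f a * int (empty_fibre q (n - m * k))"
      by simp
  qed
  finally show ?thesis by (simp add: K_def sum_distrib_right)
qed

end

text \<open>Taking the constant function 1 in \<open>sum_quotient\<close> counts all partitions of
  \<open>n\<close>, a number independent of the quotient. The two resulting recursions have the same
  coefficients, so their solutions agree.\<close>

lemma empty_fibre_eq:
  assumes "partition_quotient m q e" and "partition_quotient m q' e'"
  shows "empty_fibre q n = empty_fibre q' n"
proof (induction n rule: less_induct)
  case (less n)
  interpret Q: partition_quotient m q e by fact
  interpret Q': partition_quotient m q' e' by fact
  define K where "K = {k. m * k \<le> n}"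
  have finK: "finite K" unfolding K_def using Q.m_pos by (rule finite_mult_le)
  let ?p = "\<lambda>k. int (card (partitions_of k))"
  have "(\<Sum>k\<in>K. ?p k * int (empty_fibre q (n - m * k))) =
      (\<Sum>k\<in>K. ?p k * int (empty_fibre q' (n - m * k)))"
    using Q.sum_quotient[of "\<lambda>_. 1" n] Q'.sum_quotient[of "\<lambda>_. 1" n] by (simp add: K_def)
  moreover have "(\<Sum>k\<in>K - {0}. ?p k * int (empty_fibre q (n - m * k))) =
      (\<Sum>k\<in>K - {0}. ?p k * int (empty_fibre q' (n - m * k)))"
  proof (intro sum.cong refl)
    fix k assume "k \<in> K - {0}"
    then have "m * k \<le> n" "0 < m * k" using Q.m_pos by (auto simp: K_def)
    then have "n - m * k < n" by linarith
    then show "?p k * int (empty_fibre q (n - m * k)) = ?p k * int (empty_fibre q' (n - m * k))"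
      using less.IH by simp
  qed
  \<comment> \<open>The term \<open>k = 0\<close> has coefficient 1, as only the empty partition has
    size 0; cancelling the other terms leaves the empty fibres for \<open>n\<close> itself.\<close>
  moreover have "0 \<in> K" by (simp add: K_def)
  ultimately show ?case
    using finK by (simp add: sum.remove[of K 0] partitions_of_0)
qed

lemma sum_quotient_eq:
  fixes f :: "(nat \<Rightarrow> nat) \<Rightarrow> int"
  assumes "partition_quotient m q e" and "partition_quotient m q' e'"
  shows "(\<Sum>t\<in>partitions_of n. f (q t)) = (\<Sum>t\<in>partitions_of n. f (q' t))"
  using assms by (simp add: partition_quotient.sum_quotient empty_fibre_eq[OF assms])

section \<open>The two concrete quotients: multiples of \<open>m\<close>, and groups of
  \<open>m\<close> equal parts\<close>

lemma sum_multiples: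
  fixes g :: "nat \<Rightarrow> nat"
  assumes "m \<ge> 1" and "\<And>i. i \<notin> {1..n} \<Longrightarrow> g i = 0"
  shows "(\<Sum>i=0..n. \<Sum>j=1..<m. g (i * m + j)) + (\<Sum>k=1..n. g (k * m)) = (\<Sum>i=1..n. g i)"
proof -
  have *: "(\<Sum>k=1..n. g (k * m)) = (\<Sum>k=0..n. g (k * m))"
    using assms(2)[of 0] by (simp add: sum.atLeast_Suc_atMost)
  \<comment> \<open>Division with remainder: the multiples of \<open>m\<close> fill the missing
    residue \<open>j = 0\<close>, and the blocks of length \<open>m\<close> then tile an initial
    segment of the naturals. The added index 0 is harmless because \<open>g 0 = 0\<close>.\<close>
  have "(\<Sum>i=0..n. \<Sum>j=1..<m. g (i * m + j)) + (\<Sum>k=0..n. g (k * m)) =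
      (\<Sum>i=0..n. \<Sum>j=0..<m. g (i * m + j))"
    using assms(1) by (simp add: sum.distrib[symmetric] sum.atLeast_Suc_lessThan add.commute)
  also have "\<dots> = (\<Sum>i<Suc n. sum g {i * m..<i * m + m})"
  proof (rule sum.cong)
    fix i
    show "(\<Sum>j=0..<m. g (i * m + j)) = sum g {i * m..<i * m + m}"
      using sum.shift_bounds_nat_ivl[of g 0 "i * m" m] by (simp add: add.commute)
  qed auto
  also have "\<dots> = sum g {..<Suc n * m}" by (rule sum.nat_group)
  also have "\<dots> = (\<Sum>i=1..n. g i)"
  proof (rule sum.mono_neutral_right)
    show "{1..n} \<subseteq> {..<Suc n * m}"
      using mult_le_mono2[OF assms(1), of "Suc n"] by auto
  qed (use assms(2) in auto)
  finally show ?thesis using * by simp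
qed

text \<open>Restoring turns each part \<open>j\<close> into \<open>m * j\<close> with the same
  multiplicity, which scales the size by \<open>m\<close>.\<close>

lemma partition_quotient_multiples:
  assumes m: "m \<ge> 1"
  shows "partition_quotient m (\<lambda>t k. t (k * m)) (\<lambda>a i. if m dvd i then a (i div m) else 0)"
proof
  show "m \<ge> 1" by fact
  show "\<exists>k. (\<lambda>k. t (k * m)) \<in> partitions_of k" if t: "t \<in> partitions_of n" for t n
  proof -
    have "t (i * m) = 0" if "i \<notin> {1..n}" for i
    proof (rule partitions_of_support[OF t])
      have "i \<le> i * m" using m by simp
      \<comment> \<open>The index 0 stays 0, which is not a part, and an index above
        \<open>n\<close> stays above \<open>n\<close>.\<close>
      then show "i * m \<notin> {1..n}" using that order.trans[of i "i * m" n] by (cases "i = 0") auto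
    qed
    then show ?thesis using partitions_of_iff[of n "\<lambda>k. t (k * m)"] by auto
  qed
  show "(\<lambda>i. if m dvd i then a (i div m) else 0) \<in> partitions_of (m * k)"
    (is "?e \<in> _") if a: "a \<in> partitions_of k" for a k
  proof -
    have e0: "?e i = 0" if "i \<notin> {1..m * k}" for i
    proof (cases "m dvd i")
      case True
      then obtain j where j: "i = m * j" by (elim dvdE)
      then have "j \<notin> {1..k}" using that m by auto
      then show ?thesis using partitions_of_support[OF a] j m by simp
    qed simp
    have "(\<Sum>i=1..m * k. i * ?e i) = (\<Sum>i\<in>(\<lambda>j. m * j) ` {1..k}. i * ?e i)"
    proof (rule sum.mono_neutral_right)
      show "\<forall>i\<in>{1..m * k} - (\<lambda>j. m * j) ` {1..k}. i * ?e i = 0"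
      proof
        fix i assume i: "i \<in> {1..m * k} - (\<lambda>j. m * j) ` {1..k}"
        have "\<not> m dvd i"
        proof
          assume "m dvd i"
          then obtain j where "i = m * j" by (elim dvdE)
          with i m show False by auto
        qed
        then show "i * ?e i = 0" by simp
      qed
    qed (use m in auto)
    also have "\<dots> = (\<Sum>j=1..k. m * j * a j)"
      using m by (subst sum.reindex) (auto simp: inj_on_def)
    also have "\<dots> = m * k"
      using a by (simp add: partitions_of_def mult.assoc flip: sum_distrib_left)
    finally show ?thesis using partitions_of_iff[of "m * k" ?e, OF e0] by blast
  qed
qed (use m in auto)

text \<open>Restoring replaces each part by \<open>m\<close> copies of itself, which again scales
  the size by \<open>m\<close>.\<close>

lemma partition_quotient_div:
  assumes m: "m \<ge> 1"
  shows "partition_quotient m (\<lambda>t i. t i div m) (\<lambda>a i. m * a i)"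
proof
  show "\<exists>k. (\<lambda>i. t i div m) \<in> partitions_of k" if t: "t \<in> partitions_of n" for t n
    using partitions_of_iff[of n "\<lambda>i. t i div m"] partitions_of_support[OF t] by auto
  show "(\<lambda>i. m * a i) \<in> partitions_of (m * k)" if a: "a \<in> partitions_of k" for a k
  proof -
    have "(\<Sum>i=1..k. i * (m * a i)) = m * k"
      using a by (simp add: partitions_of_def mult.left_commute[of _ m] flip: sum_distrib_left)
    then show ?thesis
      using partitions_of_iff[of k "\<lambda>i. m * a i"] partitions_of_support[OF a] by simp
  qed
qed (use m in auto)

theorem theorem1p2:
  fixes m n :: nat and \<epsilon> :: int
  assumes "m \<ge> 1" and "n \<ge> 1" and "\<epsilon> \<in> {1, -1}"
  shows
    "(\<Sum>t\<in>partitions_of n. \<epsilon> ^ mult_parts m n t * int (weighted_mult_parts m n t))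
      = (\<Sum>t\<in>partitions_of n.
          \<epsilon> ^ (\<Sum>i=1..n. nat \<lfloor>real (t i) / real m\<rfloor>) * int (\<Sum>i=1..n. i * nat \<lfloor>real (t i) / real m\<rfloor>))
    \<and> (\<Sum>t\<in>partitions_of n. \<epsilon> ^ mult_parts m n t * int (nonmult_part_sum m n t))
      = (\<Sum>t\<in>partitions_of n.
          \<epsilon> ^ (\<Sum>i=1..n. nat \<lfloor>real (t i) / real m\<rfloor>) * int (\<Sum>i=1..n. i * (t i mod m)))"
proof -
  define w where "w a = (\<Sum>k=1..n. k * a k)" for a :: "nat \<Rightarrow> nat"
  define s where "s a = \<epsilon> ^ (\<Sum>k=1..n. a k)" for a :: "nat \<Rightarrow> nat"
  have floor: "nat \<lfloor>real a / real m\<rfloor> = a div m" for a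
    by (simp add: floor_divide_of_nat_eq)
  note equidist = sum_quotient_eq[OF partition_quotient_multiples partition_quotient_div,
      OF \<open>m \<ge> 1\<close> \<open>m \<ge> 1\<close>]
  \<comment> \<open>The parts left over have total size \<open>n\<close> minus \<open>m\<close>
    times the size of the quotient. Hence the second identity, too, only involves a function of the
    quotient.\<close>
  have nonmult: "int (nonmult_part_sum m n t) = int n - int m * int (w (\<lambda>k. t (k * m)))"
    if t: "t \<in> partitions_of n" for t
  proof -
    have "nonmult_part_sum m n t + (\<Sum>k=1..n. k * m * t (k * m)) = (\<Sum>i=1..n. i * t i)"
      unfolding nonmult_part_sum_def
      using partitions_of_support[OF t] by (intro sum_multiples \<open>m \<ge> 1\<close>) simp
    also have "\<dots> = n" using t by (simp add: partitions_of_def)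
    also have "(\<Sum>k=1..n. k * m * t (k * m)) = m * w (\<lambda>k. t (k * m))"
      by (simp add: w_def sum_distrib_left mult_ac)
    finally show ?thesis by (simp flip: of_nat_mult)
  qed
  \<comment> \<open>Splitting each multiplicity into remainder and \<open>m\<close> times its
    quotient gives the same function of the quotient as in \<open>nonmult\<close>.\<close>
  have resid: "int (\<Sum>i=1..n. i * (t i mod m)) = int n - int m * int (w (\<lambda>i. t i div m))"
    if t: "t \<in> partitions_of n" for t
  proof -
    have "(\<Sum>i=1..n. i * (t i mod m)) + m * w (\<lambda>i. t i div m) =
        (\<Sum>i=1..n. i * (t i mod m + m * (t i div m)))"
      unfolding w_def by (simp only: sum_distrib_left distrib_left sum.distrib mult.left_commute[of m])
    also have "\<dots> = n" using t by (simp add: partitions_of_def)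
    finally show ?thesis unfolding of_nat_mult[symmetric] by linarith
  qed
  show ?thesis
  proof
    show "(\<Sum>t\<in>partitions_of n. \<epsilon> ^ mult_parts m n t * int (weighted_mult_parts m n t))
      = (\<Sum>t\<in>partitions_of n.
          \<epsilon> ^ (\<Sum>i=1..n. nat \<lfloor>real (t i) / real m\<rfloor>) * int (\<Sum>i=1..n. i * nat \<lfloor>real (t i) / real m\<rfloor>))"
      using equidist[of "\<lambda>a. s a * int (w a)" n]
      by (simp only: floor s_def w_def mult_parts_def weighted_mult_parts_def)
    have "(\<Sum>t\<in>partitions_of n. \<epsilon> ^ mult_parts m n t * int (nonmult_part_sum m n t)) =
        (\<Sum>t\<in>partitions_of n. s (\<lambda>k. t (k * m)) * (int n - int m * int (w (\<lambda>k. t (k * m)))))"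
      by (intro sum.cong refl) (simp only: nonmult s_def mult_parts_def)
    also have "\<dots> = (\<Sum>t\<in>partitions_of n. s (\<lambda>i. t i div m) * (int n - int m * int (w (\<lambda>i. t i div m))))"
      by (rule equidist[of "\<lambda>a. s a * (int n - int m * int (w a))"])
    also have "\<dots> = (\<Sum>t\<in>partitions_of n.
          \<epsilon> ^ (\<Sum>i=1..n. nat \<lfloor>real (t i) / real m\<rfloor>) * int (\<Sum>i=1..n. i * (t i mod m)))"
      by (intro sum.cong refl) (simp only: resid s_def floor)
    finally show "(\<Sum>t\<in>partitions_of n. \<epsilon> ^ mult_parts m n t * int (nonmult_part_sum m n t)) =
        (\<Sum>t\<in>partitions_of n.
          \<epsilon> ^ (\<Sum>i=1..n. nat \<lfloor>real (t i) / real m\<rfloor>) * int (\<Sum>i=1..n. i * (t i mod m)))" .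
  qed
qed

end
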